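(* Let $\mathfrak{g}$ be a $6$-dimensional real nilpotent Lie algebra with first Betti number $b_1=4$ which admits a complex structure. Then $\mathfrak{g}$ is isomorphic to one of $(0,0,0,0,12,14+25)$, $(0,0,0,0,12,13)$, $(0,0,0,0,13+42,14+23)$, $(0,0,0,0,12,14+23)$, $(0,0,0,0,12,34)$. Moreover, if $J$ is a complex structure on any of the last four of these algebras, then $V_1=\ker(d\colon\mathfrak{g}^*\to\Lambda^2\mathfrak{g}^* )$ is $J$-invariant (for the action of $J$ on $\mathfrak{g}^*$ by $\alpha\mapsto\alpha\circ J$).
   Context: A complex structure on a real Lie algebra $\mathfrak{g}$ is a linear map $J\colon\mathfrak{g}\to\mathfrak{g}$ with $J^2=-1$ and $[JX,JY]=[X,Y]+J[JX,Y]+J[X,JY]$ for all $X,Y\in\mathfrak{g}$. The differential $d\colon\mathfrak{g}^*\to\Lambda^2\mathfrak{g}^*$ is $d\alpha(X,Y)=-\alpha([X,Y])$, and $b_1=\dim\ker(d\colon\mathfrak{g}^*\to\Lambda^2\mathfrak{g}^* )$. Notation: a $6$-tuple such as $(0,0,0,0,12,14+25)$ denotes the real Lie algebra whose dual has a basis $e^1,\dots,e^6$ with $de^1,\dots,de^6$ equal to the successive entries, where $ij$ stands for $e^i\wedge e^j$. *)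

theory Defs
  imports "HOL-Analysis.Analysis"
begin

definition lie_algebra :: "('a::euclidean_space \<Rightarrow> 'a \<Rightarrow> 'a) \<Rightarrow> bool" where
  "lie_algebra br \<longleftrightarrow> bilinear br \<and> (\<forall>x. br x x = 0) \<and>
     (\<forall>x y z. br x (br y z) + br y (br z x) + br z (br x y) = 0)"

fun lcs :: "('a::euclidean_space \<Rightarrow> 'a \<Rightarrow> 'a) \<Rightarrow> nat \<Rightarrow> 'a set" where
  "lcs br 0 = UNIV"
| "lcs br (Suc k) = span {br x y | x y. y \<in> lcs br k}"

definition nilpotent_lie :: "('a::euclidean_space \<Rightarrow> 'a \<Rightarrow> 'a) \<Rightarrow> bool" where
  "nilpotent_lie br \<longleftrightarrow> (\<exists>k. lcs br k = {0})"

text \<open>V_1 = ker (d : g^* \<rightarrow> \<Lambda>^2 g^*), where d\<alpha>(X,Y) = - \<alpha>([X,Y]).\<close>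
definition V1 :: "('a::euclidean_space \<Rightarrow> 'a \<Rightarrow> 'a) \<Rightarrow> ('a \<Rightarrow> real) set" where
  "V1 br = {\<alpha>. linear \<alpha> \<and> (\<forall>X Y. - \<alpha> (br X Y) = 0)}"

text \<open>b_1 = dim V_1; g^* is identified linearly with 'a via the coordinate map
  \<alpha> \<mapsto> \<Sum>b\<in>Basis. \<alpha> b *R b (a linear isomorphism on linear functionals).\<close>
definition b1 :: "('a::euclidean_space \<Rightarrow> 'a \<Rightarrow> 'a) \<Rightarrow> nat" where
  "b1 br = dim ((\<lambda>\<alpha>. \<Sum>b\<in>Basis. \<alpha> b *\<^sub>R b) ` V1 br)"

definition complex_structure ::
  "('a::euclidean_space \<Rightarrow> 'a \<Rightarrow> 'a) \<Rightarrow> ('a \<Rightarrow> 'a) \<Rightarrow> bool" where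
  "complex_structure br J \<longleftrightarrow> linear J \<and> (\<forall>x. J (J x) = - x) \<and>
     (\<forall>X Y. br (J X) (J Y) = br X Y + J (br (J X) Y) + J (br X (J Y)))"

text \<open>Coefficients of a structure-equation tuple: a list of entries (k,i,j,c)
  means that d e^k contains the term c * e^i \<and> e^j.  dcoef L k i j is the
  coefficient of e^{ij} in de^k (for i<j, after normalising the entries).\<close>
definition dcoef :: "(nat \<times> nat \<times> nat \<times> real) list \<Rightarrow> nat \<Rightarrow> nat \<Rightarrow> nat \<Rightarrow> real" where
  "dcoef L k i j = (\<Sum>(k', i', j', c)\<leftarrow>L.
      (if (k', i', j') = (k, i, j) then c else 0) - (if (k', j', i') = (k, i, j) then c else 0))"

text \<open>br is isomorphic to the Lie algebra described by L: there is a basis e_1..e_6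
  of 'a, with dual basis e^1..e^6, such that de^k = \<Sum>_{i<j} dcoef L k i j e^{ij};
  since de^k(e_i,e_j) = - e^k([e_i,e_j]), this means
  [e_i,e_j] = - \<Sum>_k dcoef L k i j e_k.\<close>
definition iso_model ::
  "('a::euclidean_space \<Rightarrow> 'a \<Rightarrow> 'a) \<Rightarrow> (nat \<times> nat \<times> nat \<times> real) list \<Rightarrow> bool" where
  "iso_model br L \<longleftrightarrow> (\<exists>e :: nat \<Rightarrow> 'a.
      inj_on e {1..6} \<and> independent (e ` {1..6}) \<and> span (e ` {1..6}) = UNIV \<and>
      (\<forall>i\<in>{1..6}. \<forall>j\<in>{1..6}. i < j \<longrightarrow>
          br (e i) (e j) = - (\<Sum>k\<in>{1..6}. dcoef L k i j *\<^sub>R e k)))"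

definition gA :: "(nat \<times> nat \<times> nat \<times> real) list" where "gA = [(5,1,2,1),(6,1,4,1),(6,2,5,1)]"
definition gB :: "(nat \<times> nat \<times> nat \<times> real) list" where "gB = [(5,1,2,1),(6,1,3,1)]"
definition gC :: "(nat \<times> nat \<times> nat \<times> real) list" where "gC = [(5,1,3,1),(5,4,2,1),(6,1,4,1),(6,2,3,1)]"
definition gD :: "(nat \<times> nat \<times> nat \<times> real) list" where "gD = [(5,1,2,1),(6,1,4,1),(6,2,3,1)]"
definition gE :: "(nat \<times> nat \<times> nat \<times> real) list" where "gE = [(5,1,2,1),(6,3,4,1)]"

end

theory Submission
  imports Defs
begin

text \<open>
  Let D be the derived algebra; b_1 = 4 means dim D = 2. If x is central, integrability makes
  ad (J x) commute with J, so its image is a J-invariant subspace of D. Hence, if D is not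
  J-invariant, the centre is J-invariant.

  If D is central and not J-invariant, then D + J D is a central subspace of dimension 4, which
  forces dim D \<le> 1; so D, and with it V_1, is J-invariant. The bracket is then a pencil of
  2-forms on the 4-dimensional space g / D, and no J is needed to classify it: if some ad v with
  v outside D has rank at most 1 one finds (12,34), (12,14+23) or (12,13), and otherwise the
  complex Heisenberg algebra (13+42,14+23).

  If D is not central, then [g, D] is spanned by a central vector z, D is not J-invariant, and
  J z is a central vector outside D. In a basis adapted to z and J z one invariant scalar
  remains. If it vanishes the centre has dimension 3, which contradicts its J-invariance;
  otherwise the algebra is (12,14+25).
\<close>

section \<open>The derived algebra and the first Betti number\<close>

definition derived :: "('a::euclidean_space \<Rightarrow> 'a \<Rightarrow> 'a) \<Rightarrow> 'a set" where
  "derived br = span {br x y | x y. True}"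

lemma subspace_derived [simp]: "subspace (derived br)"
  by (simp add: derived_def)

lemma br_in_derived: "br x y \<in> derived br"
  unfolding derived_def by (rule span_base) auto

lemma lcs_1: "lcs br 1 = derived br"
  by (simp add: derived_def)

text \<open>The coordinate vector of \<alpha> represents \<alpha> through the inner product, and
  \<open>V1 br\<close> is the annihilator of the derived algebra. So the coordinate map carries
  \<open>V1 br\<close> onto the orthogonal complement of \<open>derived br\<close>.\<close>

lemma dim_derived:
  fixes br :: "'a::euclidean_space \<Rightarrow> 'a \<Rightarrow> 'a"
  shows "b1 br + dim (derived br) = DIM('a)"
proof -
  let ?c = "\<lambda>\<alpha>. \<Sum>b\<in>Basis. \<alpha> b *\<^sub>R (b::'a)"
  have "?c ` V1 br = {v \<in> UNIV. \<forall>w\<in>derived br. orthogonal w v}"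
  proof (intro equalityI subsetI)
    fix v assume "v \<in> ?c ` V1 br"
    then obtain \<alpha> where \<alpha>: "linear \<alpha>" "\<And>x y. \<alpha> (br x y) = 0" and v: "v = ?c \<alpha>"
      by (auto simp: V1_def)
    have rep: "v \<bullet> w = \<alpha> w" for w
    proof -
      have "\<alpha> w = \<alpha> (\<Sum>b\<in>Basis. (w \<bullet> b) *\<^sub>R b)" by (simp add: euclidean_representation)
      also have "\<dots> = v \<bullet> w"
        by (simp add: v linear_sum[OF \<alpha>(1)] linear_scale[OF \<alpha>(1)] inner_sum_left inner_commute[of w] mult.commute)
      finally show ?thesis by simp
    qed
    have "subspace {w. orthogonal w v}"
      by (auto simp: subspace_def orthogonal_def inner_add_left)
    then have "derived br \<subseteq> {w. orthogonal w v}"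
      unfolding derived_def by (intro span_minimal) (auto simp: orthogonal_def \<alpha> rep inner_commute[of _ v])
    then show "v \<in> {v \<in> UNIV. \<forall>w\<in>derived br. orthogonal w v}" by auto
  next
    fix v assume v: "v \<in> {v \<in> UNIV. \<forall>w\<in>derived br. orthogonal w v}"
    have "(\<lambda>x. x \<bullet> v) \<in> V1 br"
      using v br_in_derived by (fastforce simp: V1_def orthogonal_def intro!: linearI simp: inner_add_left)
    moreover have "v = ?c (\<lambda>x. x \<bullet> v)"
      by (subst inner_commute) (simp add: euclidean_representation)
    ultimately show "v \<in> ?c ` V1 br" 
      by (rule image_eqI[where f = ?c and x = "\<lambda>x. x \<bullet> v", rotated])
  qed
  then have "b1 br = dim {v \<in> UNIV. \<forall>w\<in>derived br. orthogonal w v}" by (simp add: b1_def)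
  then show ?thesis
    using dim_subspace_orthogonal_to_vectors[of "derived br" UNIV] by simp
qed

section \<open>Spans and dimension\<close>

lemma span_exchange:
  assumes "span (insert a S) = UNIV" "a' = k *\<^sub>R a + s" "k \<noteq> 0" "s \<in> span S"
  shows "span (insert a' S) = UNIV"
proof -
  have "a = (1/k) *\<^sub>R (a' - s)" using assms(2,3) by simp
  moreover have "s \<in> span (insert a' S)" using assms(4) by (meson span_mono subset_insertI subsetD)
  ultimately have "a \<in> span (insert a' S)"
    by (metis span_scale span_diff span_base insertI1)
  then have "insert a S \<subseteq> span (insert a' S)" by (auto intro: span_base)
  then have "span (insert a S) \<subseteq> span (insert a' S)" by (simp add: span_minimal)
  with assms(1) show ?thesis by auto
qed

lemma span_insert_less_dim:
  fixes S :: "'a::euclidean_space set"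
  assumes "dim S < DIM('a)"
  shows "\<exists>x. x \<notin> span S \<and> dim (insert x S) = Suc (dim S)"
proof -
  have "span S \<noteq> UNIV" using assms by (metis dim_UNIV dim_span less_irrefl)
  then obtain x where "x \<notin> span S" by auto
  then show ?thesis by (auto simp: dim_insert)
qed

lemma span_eq_of_dim_2:
  fixes S :: "'a::euclidean_space set"
  assumes "subspace S" "dim S = 2" "p \<in> S" "q \<in> S" "p \<noteq> 0" "q \<notin> span {p}"
  shows "S = span {p, q}"
proof -
  have "dim {p, q} = 2"
    using assms by (subst insert_commute) (simp add: dim_insert)
  moreover have "span {p, q} \<subseteq> S" using assms by (intro span_minimal) auto
  ultimately show ?thesis
    using subspace_dim_equal[of "span {p,q}" S] assms by simp
qed

lemma span_pair_iff: "x \<in> span {p, q} \<longleftrightarrow> (\<exists>s t. x = s *\<^sub>R p + t *\<^sub>R q)"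
proof
  assume "x \<in> span {p, q}"
  then obtain s t where "x - s *\<^sub>R p = t *\<^sub>R q" by (auto simp: span_breakdown_eq span_singleton)
  then have "x = s *\<^sub>R p + t *\<^sub>R q" by (simp add: algebra_simps)
  then show "\<exists>s t. x = s *\<^sub>R p + t *\<^sub>R q" by blast
next
  assume "\<exists>s t. x = s *\<^sub>R p + t *\<^sub>R q"
  then show "x \<in> span {p, q}" by (auto intro: span_add span_scale span_base)
qed

section \<open>Elementary bracket calculus\<close>

locale lie_alg =
  fixes br :: "'a::euclidean_space \<Rightarrow> 'a \<Rightarrow> 'a"
  assumes lie: "lie_algebra br"
begin

lemma bil: "bilinear br" using lie by (simp add: lie_algebra_def)

lemmas br_simps [simp] = bilinear_ladd[OF bil] bilinear_radd[OF bil]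
  bilinear_lsub[OF bil] bilinear_rsub[OF bil] bilinear_lmul[OF bil] bilinear_rmul[OF bil]
  bilinear_lneg[OF bil] bilinear_rneg[OF bil] bilinear_lzero[OF bil] bilinear_rzero[OF bil]

lemmas [simp] = br_in_derived[of br]

lemma br_self [simp]: "br x x = 0" using lie by (simp add: lie_algebra_def)

lemma br_swap: "br y x = - br x y"
proof -
  have "br (x + y) (x + y) = br x y + br y x" by (simp del: br_self add: br_self[of x] br_self[of y])
  then have "br x y + br y x = 0" by (metis br_self)
  then show ?thesis by (simp add: eq_neg_iff_add_eq_0 add.commute)
qed

lemma jacobi: "br x (br y z) + br y (br z x) + br z (br x y) = 0"
  using lie by (simp add: lie_algebra_def)

lemma derived_subset:
  assumes "span B = UNIV" "subspace T" "\<And>x y. x \<in> B \<Longrightarrow> y \<in> B \<Longrightarrow> br x y \<in> T"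
  shows "derived br \<subseteq> T"
proof -
  have "br x y \<in> T" for x y
  proof -
    have 1: "br x y \<in> T" if "x \<in> B" for x y
    proof -
      have "subspace {y. br x y \<in> T}" using assms(2) by (auto simp: subspace_def)
      then have "span B \<subseteq> {y. br x y \<in> T}" using assms(3) that by (intro span_minimal) auto
      then show ?thesis using assms(1) by auto
    qed
    have "subspace {x. br x y \<in> T}" using assms(2) by (auto simp: subspace_def)
    then have "span B \<subseteq> {x. br x y \<in> T}" using 1 by (intro span_minimal) auto
    then show ?thesis using assms(1) by auto
  qed
  then show ?thesis unfolding derived_def using assms(2) by (intro span_minimal) auto
qed

end

subsection \<open>Complex structures\<close>

locale complex_lie_alg = lie_alg +
  fixes J
  assumes J: "complex_structure br J"
begin

lemma linear_J: "linear J" using J by (simp add: complex_structure_def)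

lemmas J_simps [simp] = linear_add[OF linear_J] linear_diff[OF linear_J] linear_scale[OF linear_J]
  linear_neg[OF linear_J] linear_0[OF linear_J]

lemma J_J [simp]: "J (J x) = - x" using J by (simp add: complex_structure_def)

lemma integrable: "br (J x) (J y) = br x y + J (br (J x) y) + J (br x (J y))"
  using J by (simp add: complex_structure_def)

text \<open>A real eigenvalue k of J would satisfy k^2 = -1.\<close>

lemma J_not_in_line:
  assumes "u \<noteq> 0" shows "J u \<notin> span {u}"
proof
  assume "J u \<in> span {u}"
  then obtain k where k: "J u = k *\<^sub>R u" by (auto simp: span_singleton)
  then have "- u = (k * k) *\<^sub>R u" by (metis J_J J_simps(3) scaleR_scaleR)
  then have "(k * k + 1) *\<^sub>R u = 0" 
    by (simp add: scaleR_add_left) (metis add.left_inverse)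
  then show False using assms by (simp add: add_nonneg_eq_0_iff)
qed

text \<open>The vectors u and \<open>J u\<close> are independent, hence span the plane, and J
  exchanges them up to sign. So a plane that is not J-invariant meets its image under J only in
  0.\<close>

lemma J_invariant_dim_2:
  assumes "subspace S" "dim S = 2" "u \<in> S" "u \<noteq> 0" "J u \<in> S"
  shows "J ` S \<subseteq> S"
proof -
  have "S = span {u, J u}" using assms J_not_in_line by (intro span_eq_of_dim_2) auto
  then have "\<exists>s t. x = s *\<^sub>R u + t *\<^sub>R J u" if "x \<in> S" for x
    using that span_pair_iff by blast
  then show ?thesis using assms(1,3,5)
    by (fastforce intro!: subspace_diff subspace_scale)
qed

text \<open>For central x only two terms of the integrability condition survive, and they say that
  ad (J x) commutes with J. A nonzero value of ad (J x) then lies in the derived algebra together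
  with its image under J. Read backwards: if the derived algebra is not J-invariant, J maps central
  vectors to central vectors.\<close>

lemma J_central:
  assumes "dim (derived br) = 2" "\<And>y. br x y = 0" "br (J x) y \<noteq> 0"
  shows "J (br (J x) y) = br (J x) (J y)" "J ` derived br \<subseteq> derived br"
proof -
  show *: "J (br (J x) y) = br (J x) (J y)" using integrable[of x y] assms(2) by simp
  show "J ` derived br \<subseteq> derived br"
    using assms by (intro J_invariant_dim_2[of _ "br (J x) y"]) (auto simp: *)
qed

lemma two_step_derived_J_invariant:
  assumes "DIM('a) = 6" "dim (derived br) = 2" and central: "\<And>x d. d \<in> derived br \<Longrightarrow> br d x = 0"
  shows "J ` derived br \<subseteq> derived br"
proof (rule ccontr)
  let ?D = "derived br"
  assume nJ: "\<not> J ` ?D \<subseteq> ?D"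
  then obtain d where d: "d \<in> ?D" "J d \<notin> ?D" by auto
  have "?D \<noteq> span {d}"
  proof
    assume "?D = span {d}"
    then have "dim ?D \<le> 1" by (metis dim_span dim_singleton le_refl zero_le)
    then show False using assms by simp
  qed
  moreover have "span {d} \<subseteq> ?D" using d by (intro span_minimal) auto
  ultimately obtain d' where d': "d' \<in> ?D" "d' \<notin> span {d}" by auto
  have sD: "span ?D = ?D" by (simp add: span_eq_iff)
  have 3: "dim (insert (J d) ?D) = 3" using d assms by (simp add: dim_insert sD)
  \<comment> \<open>A dependence would give the nonzero vector \<open>d' - s *\<^sub>R d\<close> of
    the derived algebra an image under J that is again in the derived algebra, which forces the
    whole plane to be J-invariant.\<close>
  have "J d' \<notin> span (insert (J d) ?D)"
  proof
    assume "J d' \<in> span (insert (J d) ?D)"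
    then obtain s where "J d' - s *\<^sub>R J d \<in> ?D" by (auto simp: span_breakdown_eq sD)
    then have "J (d' - s *\<^sub>R d) \<in> ?D" by simp
    moreover have "d' - s *\<^sub>R d \<in> ?D" using d d' by (intro subspace_diff subspace_scale) auto
    moreover have "d' - s *\<^sub>R d \<noteq> 0" using d' by (auto simp: span_singleton)
    ultimately show False
      using J_invariant_dim_2[of ?D "d' - s *\<^sub>R d"] assms(2) nJ subspace_derived by metis
  qed
  then have 4: "dim (insert (J d') (insert (J d) ?D)) = 4" using 3 by (simp add: dim_insert)
  let ?S = "insert (J d') (insert (J d) ?D)"
  obtain u where u: "dim (insert u ?S) = 5" using 4 assms span_insert_less_dim[of ?S] by auto
  obtain v where v: "dim (insert v (insert u ?S)) = 6"
    using u assms span_insert_less_dim[of "insert u ?S"] by auto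
  \<comment> \<open>Contrapositive of \<open>J_central\<close>: J times a central vector is
    central.\<close>
  have J0: "br (J x) y = 0" if "x \<in> ?D" for x y
    using J_central(2)[OF assms(2) central[OF that]] nJ by metis
  have S0: "br x y = 0" if "x \<in> ?S" for x y
    using that d d' central J0 by auto
  \<comment> \<open>The span of \<open>?S\<close> is central of dimension 4, so only the bracket of
    the two complementary vectors u and v can be nonzero.\<close>
  have "?D \<subseteq> span {br u v}"
  proof (rule derived_subset)
    show "span (insert v (insert u ?S)) = UNIV" using v assms(1) by (metis dim_eq_full)
    fix x y assume xy: "x \<in> insert v (insert u ?S)" "y \<in> insert v (insert u ?S)"
    show "br x y \<in> span {br u v}"
    proof (cases "x \<in> ?S \<or> y \<in> ?S")
      case True
      then have "br x y = 0" using S0[of x y] S0[of y x] br_swap[of x y] by auto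
      then show ?thesis by (simp add: span_0)
    next
      case False
      then have "x \<in> {u, v}" "y \<in> {u, v}" using xy by blast+
      then show ?thesis using br_swap[of v u] by (auto simp: span_base span_0 intro!: span_neg)
    qed
  qed simp
  then have "dim ?D \<le> dim {br u v}" by (metis dim_span dim_subset)
  then show False using assms by (simp add: dim_singleton split: if_splits)
qed

end

section \<open>Recognising a model from six spanning vectors\<close>

text \<open>Six vectors that span a space of dimension 6 are distinct and independent, by
  counting.\<close>

lemma iso_modelI:
  fixes br :: "'a::euclidean_space \<Rightarrow> 'a \<Rightarrow> 'a"
  assumes "DIM('a) = 6" and sp: "span (e ` {1..6}) = UNIV"
    and "\<And>i j. i \<in> {1..6} \<Longrightarrow> j \<in> {1..6} \<Longrightarrow> i < j \<Longrightarrow>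
      br (e i) (e j) = - (\<Sum>k\<in>{1..6}. dcoef L k i j *\<^sub>R e k)"
  shows "iso_model br L"
proof -
  have c: "card (e ` {1..6}) \<le> 6" using card_image_le[of "{1..6::nat}" e] by simp
  have "dim (e ` {1..6}) = 6" using sp assms(1) by (metis dim_UNIV dim_span)
  then have "card (e ` {1..6}) = 6" using c dim_le_card'[of "e ` {1..6}"] by simp
  then have "inj_on e {1..6}" by (intro eq_card_imp_inj_on) simp_all
  moreover have "independent (e ` {1..6})"
    by (rule card_le_dim_spanning[of _ UNIV]) (use sp c assms(1) in simp_all)
  ultimately show ?thesis unfolding iso_model_def using assms by blast
qed

lemma span_base_uminus: "- x \<in> S \<Longrightarrow> x \<in> span S"
  using span_neg[of "- x" S] by (simp add: span_base)

lemma atLeastAtMost_1_6: "{Suc 0..6} = {Suc 0, 2, 3, 4, 5, 6}"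
  by auto

text \<open>The padding entry 0 at position 0 makes list positions agree with the indices 1 to 6 of
  the tuple.\<close>

lemma iso_model_six:
  fixes br :: "'a::euclidean_space \<Rightarrow> 'a \<Rightarrow> 'a"
  assumes "DIM('a) = 6" and sp: "span {a, b, c, d, p, q} = UNIV"
    and "\<forall>i\<in>{1..6}. \<forall>j\<in>{1..6}. i < j \<longrightarrow>
      br ([0, a, b, c, d, p, q] ! i) ([0, a, b, c, d, p, q] ! j)
        = - (\<Sum>k\<in>{1..6}. dcoef L k i j *\<^sub>R [0, a, b, c, d, p, q] ! k)"
  shows "iso_model br L"
proof (rule iso_modelI[where e = "(!) [0, a, b, c, d, p, q]"])
  show "span ((!) [0, a, b, c, d, p, q] ` {1..6}) = UNIV"
    using sp by (simp add: atLeastAtMost_1_6)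
qed (use assms in blast)+

subsection \<open>Bases adapted to the derived algebra\<close>

locale lie_alg_6_2 = lie_alg br for br :: "'a::euclidean_space \<Rightarrow> 'a \<Rightarrow> 'a" +
  assumes dim6: "DIM('a) = 6" and dimD: "dim (derived br) = 2"
begin

abbreviation D where "D \<equiv> derived br"

text \<open>Since g / D has dimension 4, this says that the classes of the four vectors form a basis
  of g / D.\<close>

definition frame :: "'a \<Rightarrow> 'a \<Rightarrow> 'a \<Rightarrow> 'a \<Rightarrow> bool" where
  "frame a b c d \<longleftrightarrow> span (insert a (insert b (insert c (insert d D)))) = UNIV"

lemma span_D [simp]: "span D = D" by simp

text \<open>These adjacent transpositions generate all permutations of a frame.\<close>

lemma frame_perm:
  assumes "frame a b c d"
  shows "frame b a c d" "frame a c b d" "frame a b d c"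
  using assms by (simp_all add: frame_def insert_commute)

text \<open>The elementary change of basis modulo D, from which most normalisations below are
  composed together with permutations.\<close>

lemma frame_exchange:
  assumes "frame a b c d" "a' = k *\<^sub>R a + \<beta> *\<^sub>R b + \<gamma> *\<^sub>R c + \<delta> *\<^sub>R d + u" "k \<noteq> 0" "u \<in> D"
  shows "frame a' b c d"
  unfolding frame_def
proof (rule span_exchange)
  show "span (insert a (insert b (insert c (insert d D)))) = UNIV"
    using assms(1) by (simp add: frame_def)
  show "a' = k *\<^sub>R a + (\<beta> *\<^sub>R b + \<gamma> *\<^sub>R c + \<delta> *\<^sub>R d + u)" by (simp add: assms(2))
  show "\<beta> *\<^sub>R b + \<gamma> *\<^sub>R c + \<delta> *\<^sub>R d + u \<in> span (insert b (insert c (insert d D)))"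
    using assms(4) by (intro span_add span_scale) (auto intro: span_base)
qed fact

lemma frame_exchange_frame:
  assumes "frame a b c d" "a' = k *\<^sub>R a + \<beta> *\<^sub>R b + \<gamma> *\<^sub>R c + \<delta> *\<^sub>R d" "k \<noteq> 0"
  shows "frame a' b c d"
  using assms by (intro frame_exchange[of a b c d a' k \<beta> \<gamma> \<delta> 0]) (auto simp: subspace_0)

text \<open>Otherwise \<open>a\<close> would depend on b, c, d and D, which span at most 5
  dimensions.\<close>

lemma frame_notin:
  assumes "frame a b c d" "\<alpha> \<noteq> 0"
  shows "\<alpha> *\<^sub>R a + \<beta> *\<^sub>R b + \<gamma> *\<^sub>R c + \<delta> *\<^sub>R d \<notin> D"
proof
  let ?S = "insert b (insert c (insert d D))"
  assume *: "\<alpha> *\<^sub>R a + \<beta> *\<^sub>R b + \<gamma> *\<^sub>R c + \<delta> *\<^sub>R d \<in> D" (is "?u \<in> D")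
  have "a = (1/\<alpha>) *\<^sub>R (?u - \<beta> *\<^sub>R b - \<gamma> *\<^sub>R c - \<delta> *\<^sub>R d)" using assms(2) by simp
  moreover have "\<dots> \<in> span ?S"
    using * by (intro span_scale span_diff) (auto intro: span_base)
  ultimately have "a \<in> span ?S" by simp
  then have "dim (insert a ?S) = dim ?S" by (simp add: dim_insert)
  also have "\<dots> \<le> 5" using dimD by (auto simp: dim_insert)
  finally have "dim (insert a ?S) \<le> 5" .
  moreover have "dim (insert a ?S) = 6" using assms(1) dim6 unfolding frame_def by (metis dim_eq_full)
  ultimately show False by simp
qed

lemma frame_fst_notin: "frame a b c d \<Longrightarrow> a \<notin> D"
  using frame_notin[of a b c d 1 0 0 0] by simp

lemma frame_expand:
  assumes "frame a b c d"
  shows "\<exists>\<alpha> \<beta> \<gamma> \<delta>. \<exists>u\<in>D. x = \<alpha> *\<^sub>R a + \<beta> *\<^sub>R b + \<gamma> *\<^sub>R c + \<delta> *\<^sub>R d + u"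
proof -
  have "x \<in> span (insert a (insert b (insert c (insert d D))))" using assms by (simp add: frame_def)
  then obtain \<alpha> \<beta> \<gamma> \<delta> where u: "x - \<alpha> *\<^sub>R a - \<beta> *\<^sub>R b - \<gamma> *\<^sub>R c - \<delta> *\<^sub>R d \<in> D" (is "?u \<in> D")
    by (auto simp: span_breakdown_eq)
  have "x = \<alpha> *\<^sub>R a + \<beta> *\<^sub>R b + \<gamma> *\<^sub>R c + \<delta> *\<^sub>R d + ?u" by simp
  with u show ?thesis by blast
qed

lemma frame_ad:
  assumes "frame a b c d" "subspace T" "br a b \<in> T" "br a c \<in> T" "br a d \<in> T"
    "\<And>u. u \<in> D \<Longrightarrow> br a u \<in> T"
  shows "br a x \<in> T"
proof -
  obtain \<alpha> \<beta> \<gamma> \<delta> u where "u \<in> D" "x = \<alpha> *\<^sub>R a + \<beta> *\<^sub>R b + \<gamma> *\<^sub>R c + \<delta> *\<^sub>R d + u"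
    using frame_expand[OF assms(1)] by blast
  then show ?thesis using assms by (auto intro!: subspace_add subspace_scale)
qed

lemma frame_derived:
  assumes "frame a b c d" "subspace T" "br a b \<in> T" "br a c \<in> T" "br a d \<in> T"
    "br b c \<in> T" "br b d \<in> T" "br c d \<in> T" and D: "\<And>x u. u \<in> D \<Longrightarrow> br x u \<in> T"
  shows "D \<subseteq> T"
proof (rule derived_subset)
  show "span (insert a (insert b (insert c (insert d D)))) = UNIV"
    using assms(1) by (simp add: frame_def)
  have neg: "br y x \<in> T" if "br x y \<in> T" for x y
    using that subspace_neg[OF assms(2)] br_swap by metis
  fix x y assume "x \<in> insert a (insert b (insert c (insert d D)))"
    "y \<in> insert a (insert b (insert c (insert d D)))"
  then show "br x y \<in> T" using assms(3-8) D neg subspace_0[OF assms(2)] by auto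
qed fact

lemma D_not_line: "\<not> D \<subseteq> span {q}"
proof
  assume "D \<subseteq> span {q}"
  then have "dim D \<le> dim {q}" by (metis dim_span dim_subset)
  then show False using dimD by (simp add: dim_singleton split: if_splits)
qed

lemma frame_extend:
  assumes "v \<notin> D"
  shows "\<exists>a b c. frame v a b c"
proof -
  have 1: "dim (insert v D) = 3" using assms dimD by (simp add: dim_insert)
  obtain a where a: "dim (insert a (insert v D)) = 4"
    using span_insert_less_dim[of "insert v D"] 1 dim6 by auto
  obtain b where b: "dim (insert b (insert a (insert v D))) = 5"
    using span_insert_less_dim[of "insert a (insert v D)"] a dim6 by auto
  obtain c where c: "dim (insert c (insert b (insert a (insert v D)))) = 6"
    using span_insert_less_dim[of "insert b (insert a (insert v D))"] b dim6 by auto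
  have "frame c b a v" unfolding frame_def using c dim6 by (metis dim_eq_full)
  then show ?thesis by (meson frame_perm)
qed

end

subsection \<open>The two-step case\<close>

locale two_step_6_2 = lie_alg_6_2 +
  assumes central [simp]: "u \<in> D \<Longrightarrow> br x u = 0"
begin

lemma central' [simp]: "u \<in> D \<Longrightarrow> br u x = 0"
  using central[of u x] br_swap[of u x] by simp

text \<open>As D is central, the six brackets of the frame generate it. A plane containing them
  contains D, and equals D by dimension.\<close>

lemma frame_span:
  assumes "frame a b c d" "br a b \<in> span {p, q}" "br a c \<in> span {p, q}" "br a d \<in> span {p, q}"
    "br b c \<in> span {p, q}" "br b d \<in> span {p, q}" "br c d \<in> span {p, q}"
  shows "span {a, b, c, d, p, q} = UNIV" "D = span {p, q}"
proof -
  have sub: "D \<subseteq> span {p, q}"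
    by (rule frame_derived[OF assms(1) _ assms(2-7)]) (auto simp: span_0)
  have "insert a (insert b (insert c (insert d D))) \<subseteq> span {a, b, c, d, p, q}"
    using sub span_mono[of "{p, q}" "{a, b, c, d, p, q}"] by (auto intro: span_base)
  then have "span (insert a (insert b (insert c (insert d D)))) \<subseteq> span {a, b, c, d, p, q}"
    by (simp add: span_minimal)
  then show "span {a, b, c, d, p, q} = UNIV" using assms(1) by (auto simp: frame_def)
  have "dim {p, q} \<le> 2" by (auto simp: dim_insert)
  then show "D = span {p, q}" using subspace_dim_equal[of D "span {p,q}"] sub dimD by simp
qed

section \<open>Frames that exhibit the four two-step models\<close>

text \<open>The frame supplies the first four basis vectors. The last two are negated brackets,
  because de^k(e_i, e_j) = - e^k([e_i, e_j]); the same holds for the other three models.\<close>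

lemma iso_gE:
  assumes f: "frame a b c d" and br: "br a c = 0" "br a d = 0" "br b c = 0" "br b d = 0"
  shows "iso_model br gE"
proof (rule iso_model_six[OF dim6])
  show "span {a, b, c, d, - br a b, - br c d} = UNIV"
    by (rule frame_span(1)[OF f]) (auto simp: br span_0 span_base span_base_uminus)
  show "\<forall>i\<in>{1..6}. \<forall>j\<in>{1..6}. i < j \<longrightarrow>
      br ([0, a, b, c, d, - br a b, - br c d] ! i) ([0, a, b, c, d, - br a b, - br c d] ! j)
        = - (\<Sum>k\<in>{1..6}. dcoef gE k i j *\<^sub>R [0, a, b, c, d, - br a b, - br c d] ! k)"
    by (simp add: atLeastAtMost_1_6 dcoef_def gE_def br)
qed

lemma iso_gD:
  assumes f: "frame a b c d" and br: "br a c = 0" "br b c = br a d" "br b d = 0" "br c d = 0"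
  shows "iso_model br gD"
proof (rule iso_model_six[OF dim6])
  show "span {a, b, c, d, - br a b, - br a d} = UNIV"
    by (rule frame_span(1)[OF f]) (auto simp: br span_0 span_base span_base_uminus)
  show "\<forall>i\<in>{1..6}. \<forall>j\<in>{1..6}. i < j \<longrightarrow>
      br ([0, a, b, c, d, - br a b, - br a d] ! i) ([0, a, b, c, d, - br a b, - br a d] ! j)
        = - (\<Sum>k\<in>{1..6}. dcoef gD k i j *\<^sub>R [0, a, b, c, d, - br a b, - br a d] ! k)"
    by (simp add: atLeastAtMost_1_6 dcoef_def gD_def br)
qed

lemma iso_gB:
  assumes f: "frame a b c d" and br: "br a d = 0" "br b c = 0" "br b d = 0" "br c d = 0"
  shows "iso_model br gB"
proof (rule iso_model_six[OF dim6])
  show "span {a, b, c, d, - br a b, - br a c} = UNIV"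
    by (rule frame_span(1)[OF f]) (auto simp: br span_0 span_base span_base_uminus)
  show "\<forall>i\<in>{1..6}. \<forall>j\<in>{1..6}. i < j \<longrightarrow>
      br ([0, a, b, c, d, - br a b, - br a c] ! i) ([0, a, b, c, d, - br a b, - br a c] ! j)
        = - (\<Sum>k\<in>{1..6}. dcoef gB k i j *\<^sub>R [0, a, b, c, d, - br a b, - br a c] ! k)"
    by (simp add: atLeastAtMost_1_6 dcoef_def gB_def br)
qed

text \<open>These are the relations of the complex Heisenberg algebra when multiplication by i sends
  \<open>a\<close> to b, c to d and [a, c] to [a, d].\<close>

lemma iso_gC:
  assumes f: "frame a b c d" and br: "br a b = 0" "br c d = 0" "br b d = - br a c" "br b c = br a d"
  shows "iso_model br gC"
proof (rule iso_model_six[OF dim6])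
  show "span {a, b, c, d, - br a c, - br a d} = UNIV"
    by (rule frame_span(1)[OF f]) (auto simp: br span_0 span_base span_base_uminus)
  show "\<forall>i\<in>{1..6}. \<forall>j\<in>{1..6}. i < j \<longrightarrow>
      br ([0, a, b, c, d, - br a c, - br a d] ! i) ([0, a, b, c, d, - br a c, - br a d] ! j)
        = - (\<Sum>k\<in>{1..6}. dcoef gC k i j *\<^sub>R [0, a, b, c, d, - br a c, - br a d] ! k)"
    by (simp add: atLeastAtMost_1_6 dcoef_def gC_def br)
qed

section \<open>Some ad v of rank at most 1\<close>

text \<open>On the line of q, brackets with c and d become scalars: \<epsilon> for [c, d], and a 2
  by 2 matrix pairing a, b with c, d. If \<epsilon> \<noteq> 0 the algebra is \<open>gE\<close>. If
  \<epsilon> = 0, an invertible matrix gives \<open>gD\<close> and a matrix of rank 1 gives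
  \<open>gB\<close>.\<close>

lemma iso_of_common_line:
  assumes f: "frame a b c d" and c: "\<And>x. br x c \<in> span {q}" and d: "\<And>x. br x d \<in> span {q}"
  shows "iso_model br gB \<or> iso_model br gD \<or> iso_model br gE"
proof -
  obtain \<alpha> \<beta> \<gamma> \<delta> \<epsilon> where e: "br a c = \<alpha> *\<^sub>R q" "br a d = \<beta> *\<^sub>R q" "br b c = \<gamma> *\<^sub>R q"
    "br b d = \<delta> *\<^sub>R q" "br c d = \<epsilon> *\<^sub>R q"
    using c[of a] d[of a] c[of b] d[of b] d[of c] unfolding span_singleton by blast
  have e': "br d c = - \<epsilon> *\<^sub>R q" using br_swap[of d c] e by simp
  show ?thesis
  proof (cases "\<epsilon> = 0")
    case False
    \<comment> \<open>As c and d pair to \<epsilon> \<noteq> 0, multiples of them clear the brackets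
      of \<open>a\<close> and b with c and d.\<close>
    define a' where "a' = a - (\<beta> / \<epsilon>) *\<^sub>R c + (\<alpha> / \<epsilon>) *\<^sub>R d"
    define b' where "b' = b - (\<delta> / \<epsilon>) *\<^sub>R c + (\<gamma> / \<epsilon>) *\<^sub>R d"
    have "frame a' b c d"
      by (rule frame_exchange_frame[OF f, of _ 1 0 "- \<beta> / \<epsilon>" "\<alpha> / \<epsilon>"]) (simp_all add: a'_def)
    then have "frame b' a' c d"
      by (intro frame_exchange_frame[OF frame_perm(1), of a' b c d _ 1 0 "- \<delta> / \<epsilon>" "\<gamma> / \<epsilon>"]) (simp_all add: b'_def)
    then have "frame a' b' c d" by (rule frame_perm)
    moreover have "br a' c = 0" "br a' d = 0" "br b' c = 0" "br b' d = 0"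
      using False by (simp_all add: a'_def b'_def e e')
    ultimately have "iso_model br gE" by (rule iso_gE)
    then show ?thesis by simp
  next
    case 0: True
    define \<Delta> where "\<Delta> = \<alpha> * \<delta> - \<beta> * \<gamma>"
    show ?thesis
    proof (cases "\<Delta> = 0")
      case False
      \<comment> \<open>The inverse of the matrix yields new vectors with [a, c'] = [b, d'] = 0 and
        [b, c'] = [a, d'] = q.\<close>
      define c' where "c' = (- \<beta> / \<Delta>) *\<^sub>R c + (\<alpha> / \<Delta>) *\<^sub>R d"
      define d' where "d' = (\<delta> / \<Delta>) *\<^sub>R c - (\<gamma> / \<Delta>) *\<^sub>R d"
      have \<Delta>: "\<alpha> * (\<delta> / \<Delta>) + \<gamma> * (- \<beta> / \<Delta>) = 1" "\<delta> * (\<alpha> / \<Delta>) - \<beta> * (\<gamma> / \<Delta>) = 1"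
        using False by (simp_all add: divide_simps) (simp_all add: \<Delta>_def algebra_simps)
      have cd: "c = \<alpha> *\<^sub>R d' + \<gamma> *\<^sub>R c'" "d = \<beta> *\<^sub>R d' + \<delta> *\<^sub>R c'"
      proof -
        have "\<alpha> *\<^sub>R d' + \<gamma> *\<^sub>R c' = (\<alpha> * (\<delta> / \<Delta>) + \<gamma> * (- \<beta> / \<Delta>)) *\<^sub>R c + (\<gamma> * (\<alpha> / \<Delta>) - \<alpha> * (\<gamma> / \<Delta>)) *\<^sub>R d"
          unfolding c'_def d'_def by (simp only: scaleR_add_right scaleR_diff_right scaleR_scaleR scaleR_add_left scaleR_diff_left) simp
        then show "c = \<alpha> *\<^sub>R d' + \<gamma> *\<^sub>R c'" by (simp only: \<Delta>) simp
        have "\<beta> *\<^sub>R d' + \<delta> *\<^sub>R c' = (\<delta> * (\<alpha> / \<Delta>) - \<beta> * (\<gamma> / \<Delta>)) *\<^sub>R d + (\<beta> * (\<delta> / \<Delta>) + \<delta> * (- \<beta> / \<Delta>)) *\<^sub>R c"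
          unfolding c'_def d'_def by (simp only: scaleR_add_right scaleR_diff_right scaleR_scaleR scaleR_add_left scaleR_diff_left) simp
        then show "d = \<beta> *\<^sub>R d' + \<delta> *\<^sub>R c'" by (simp only: \<Delta>) simp
      qed
      have "insert a (insert b (insert c (insert d D))) \<subseteq> span (insert a (insert b (insert c' (insert d' D))))"
        using cd by (auto intro: span_base span_add span_scale)
      then have "span (insert a (insert b (insert c (insert d D)))) \<subseteq> span (insert a (insert b (insert c' (insert d' D))))"
        by (simp add: span_minimal)
      then have f': "frame a b c' d'" using f by (auto simp: frame_def)
      have "br b c' = (\<alpha> * (\<delta> / \<Delta>) + \<gamma> * (- \<beta> / \<Delta>)) *\<^sub>R q" "br a d' = (\<delta> * (\<alpha> / \<Delta>) - \<beta> * (\<gamma> / \<Delta>)) *\<^sub>R q"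
        unfolding scaleR_add_left scaleR_diff_left by (simp_all add: c'_def d'_def e mult.commute)
      then have 1: "br b c' = q" "br a d' = q" by (simp_all only: \<Delta> scaleR_one)
      have "iso_model br gD"
        by (rule iso_gD[OF f']) (simp_all add: 1, simp_all add: c'_def d'_def e e' 0 mult.commute)
      then show ?thesis by simp
    next
      case True
      \<comment> \<open>With \<alpha> as pivot, one row and one column operation clear the rest of a
        singular matrix. The statement is general in the frame so that, after exchanging a with b or
        c with d, any nonzero entry can serve as pivot.\<close>
      have main: "iso_model br gB" if f: "frame a b c d" and e: "br a c = \<alpha> *\<^sub>R q" "br a d = \<beta> *\<^sub>R q" "br b c = \<gamma> *\<^sub>R q"
    "br b d = \<delta> *\<^sub>R q" "br c d = 0" and z: "\<alpha> * \<delta> - \<beta> * \<gamma> = 0" and \<alpha>: "\<alpha> \<noteq> 0" for a b c d \<alpha> \<beta> \<gamma> \<delta>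
      proof -
        define b' where "b' = b - (\<gamma> / \<alpha>) *\<^sub>R a"
        define d' where "d' = d - (\<beta> / \<alpha>) *\<^sub>R c"
        have \<delta>: "\<delta> = \<beta> * \<gamma> / \<alpha>" using z \<alpha> by (simp add: field_simps)
        have "frame b' a c d"
          by (rule frame_exchange_frame[OF frame_perm(1)[OF f], of _ 1 "- \<gamma> / \<alpha>" 0 0]) (simp_all add: b'_def)
        then have "frame d c a b'" by (meson frame_perm)
        then have "frame d' c a b'"
          by (rule frame_exchange_frame[of _ _ _ _ _ 1 "- \<beta> / \<alpha>" 0 0]) (simp_all add: d'_def)
        then have "frame a b' c d'" by (meson frame_perm)
        moreover have "br a d' = 0" "br b' c = 0" "br b' d' = 0" "br c d' = 0"
          using \<alpha> by (simp_all add: b'_def d'_def e \<delta>)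
        ultimately show ?thesis by (rule iso_gB)
      qed
      \<comment> \<open>If the matrix were zero, [a, b] alone would generate D.\<close>
      have "br a c \<noteq> 0 \<or> br a d \<noteq> 0 \<or> br b c \<noteq> 0 \<or> br b d \<noteq> 0"
      proof (rule ccontr)
        assume "\<not> ?thesis"
        then have "D \<subseteq> span {br a b}"
          using 0 e by (intro frame_derived[OF f]) (auto simp: span_0 span_base)
        then show False using D_not_line by blast
      qed
      then have "\<alpha> \<noteq> 0 \<or> \<beta> \<noteq> 0 \<or> \<gamma> \<noteq> 0 \<or> \<delta> \<noteq> 0" using e by auto
      moreover have "frame a b d c" "frame b a c d" "frame b a d c" using f by (meson frame_perm)+
      moreover have "br d c = 0" "br c d = 0" using 0 e e' by simp_all
      moreover have "\<alpha> * \<delta> - \<beta> * \<gamma> = 0" "\<beta> * \<gamma> - \<alpha> * \<delta> = 0"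
        "\<gamma> * \<beta> - \<delta> * \<alpha> = 0" "\<delta> * \<alpha> - \<gamma> * \<beta> = 0"
        using True by (simp_all add: \<Delta>_def mult.commute)
      ultimately have "iso_model br gB" using e f main by metis
      then show ?thesis by simp
    qed
  qed
qed

text \<open>The aim is a second vector d, independent of v modulo D, whose brackets lie in the same
  line; then \<open>iso_of_common_line\<close> applies to v and d.\<close>

lemma iso_of_rank_1:
  assumes v: "v \<notin> D" and vq: "\<And>x. br v x \<in> span {q}"
  shows "iso_model br gB \<or> iso_model br gD \<or> iso_model br gE"
proof -
  \<comment> \<open>The line is replaced by one inside D with a nonzero generator; if ad v = 0, any
    nonzero vector of D will do.\<close>
  obtain q where q: "q \<in> D" "q \<noteq> 0" and vq: "\<And>x. br v x \<in> span {q}"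
  proof (cases "\<forall>x. br v x = 0")
    case True
    have "\<not> D \<subseteq> {0}" using D_not_line[of 0] by simp
    then obtain q where "q \<in> D" "q \<noteq> 0" by auto
    then show ?thesis using that True span_0 by metis
  next
    case False
    then obtain x where x: "br v x \<noteq> 0" by auto
    then obtain k where k: "br v x = k *\<^sub>R q" using vq[of x] by (auto simp: span_singleton)
    then have "q = (1 / k) *\<^sub>R br v x" using x by auto
    then have "q \<in> D" by (metis br_in_derived subspace_derived subspace_scale)
    then show ?thesis using that vq k x by auto
  qed
  obtain p where p: "p \<in> D" "p \<notin> span {q}" using D_not_line[of q] by auto
  have Dqp: "D = span {p, q}" using span_eq_of_dim_2[of D q p] q p dimD by (simp add: insert_commute)
  have ex: "\<exists>s t. br x y = s *\<^sub>R p + t *\<^sub>R q" for x y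
    using br_in_derived[of br x y] unfolding Dqp span_pair_iff .
  \<comment> \<open>Some bracket of the complementary vectors leaves the line. This makes the
    coefficient r below nonzero, so that d can replace c in the frame.\<close>
  have main: "\<exists>a b c. frame v a b c \<and> br a b \<notin> span {q}"
  proof -
    obtain a b c where f: "frame v a b c" using frame_extend[OF v] by auto
    have "br a b \<notin> span {q} \<or> br a c \<notin> span {q} \<or> br b c \<notin> span {q}"
    proof (rule ccontr)
      assume "\<not> ?thesis"
      then have "D \<subseteq> span {q}" using vq by (intro frame_derived[OF f]) (auto simp: span_0)
      then show False using D_not_line by blast
    qed
    moreover have "frame v a c b" "frame v b c a" using f by (meson frame_perm)+
    ultimately show ?thesis using f by blast
  qed
  then obtain a b c where f: "frame v a b c" and ab: "br a b \<notin> span {q}" by blast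
  obtain r s where 1: "br a b = r *\<^sub>R p + s *\<^sub>R q" using ex by blast
  obtain r' s' where 2: "br a c = r' *\<^sub>R p + s' *\<^sub>R q" using ex by blast
  obtain r'' s'' where 3: "br b c = r'' *\<^sub>R p + s'' *\<^sub>R q" using ex by blast
  have r: "r \<noteq> 0" using ab 1 by (auto simp: span_singleton)
  \<comment> \<open>the p-component of the bracket is an alternating form that kills v, so it has a second kernel
    vector: the cross product of its coefficients on a, b, c\<close>
  define d where "d = r'' *\<^sub>R a - r' *\<^sub>R b + r *\<^sub>R c"
  have "frame c a b v" using f by (meson frame_perm)
  then have fd: "frame d a b v"
    by (rule frame_exchange_frame[of _ _ _ _ _ r r'' "- r'" 0]) (simp_all add: r d_def)
  have dx: "br d x \<in> span {q}" for x
  proof (rule frame_ad[OF fd])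
    have "br d a = (r' * s - r * s') *\<^sub>R q"
      by (simp add: d_def br_swap[of b a] br_swap[of c a] 1 2 algebra_simps)
    then show "br d a \<in> span {q}" by (simp add: span_scale span_base)
    have "br d b = (r'' * s - r * s'') *\<^sub>R q"
      by (simp add: d_def br_swap[of c b] 1 3 algebra_simps)
    then show "br d b \<in> span {q}" by (simp add: span_scale span_base)
    show "br d v \<in> span {q}" using vq[of d] br_swap[of d v] by (simp add: span_neg)
  qed (auto simp: span_0)
  have "frame a b v d" using fd by (meson frame_perm)
  then show ?thesis
    using iso_of_common_line[of a b v d q] vq dx br_swap span_neg by metis
qed

section \<open>Every ad v of rank 2\<close>

text \<open>Here ad v maps g / D onto the plane D with a kernel of dimension 2 that contains v. The
  vector b completes v to a basis of the kernel, and c, d are mapped to a basis of D.\<close>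

lemma frame_of_rank_2:
  assumes "v \<notin> D" and rk: "\<And>q. \<exists>x. br v x \<notin> span {q}"
  shows "\<exists>b c d. frame v b c d \<and> br v b = 0 \<and> br v c \<noteq> 0 \<and> br v d \<notin> span {br v c}"
proof -
  have line: "br v a \<notin> span {q} \<or> br v b \<notin> span {q} \<or> br v c \<notin> span {q}" if "frame v a b c" for a b c q
    using frame_ad[OF that, of "span {q}"] rk[of q] by (auto simp: span_0)
  obtain a b c where f: "frame v a b c" using frame_extend[OF assms(1)] by auto
  then have "frame v b a c" "frame v c a b" by (meson frame_perm)+
  then obtain a b c where f: "frame v a b c" and a: "br v a \<noteq> 0" using line[OF f, of 0] f by auto
  then have "frame v a c b" by (meson frame_perm)
  then obtain b c where f: "frame v a b c" and b: "br v b \<notin> span {br v a}"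
    using line[OF f, of "br v a"] f by (auto simp: span_base)
  have "D = span {br v a, br v b}" 
    by (rule span_eq_of_dim_2[OF subspace_derived dimD br_in_derived br_in_derived a b])
  then obtain s t where st: "br v c = s *\<^sub>R br v a + t *\<^sub>R br v b"
    using br_in_derived[of br v c] span_pair_iff by metis
  have "frame c v a b" using f by (meson frame_perm)
  then have "frame (c - s *\<^sub>R a - t *\<^sub>R b) v a b"
    by (rule frame_exchange_frame[of _ _ _ _ _ 1 0 "- s" "- t"]) simp_all
  then have "frame v (c - s *\<^sub>R a - t *\<^sub>R b) a b" by (rule frame_perm)
  then show ?thesis using a b st by (intro exI[of _ "c - s *\<^sub>R a - t *\<^sub>R b"] exI[of _ a] exI[of _ b]) simp
qed

text \<open>The kernels of ad v1 and ad v3 modulo D are planes spanned by v1, v2 and v3, v4. Then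
  ad v2 is ad v1 followed by an endomorphism of D, which has no real eigenvalue because an
  eigenvalue t would make ad (v2 - t v1) have rank at most 1.\<close>
lemma iso_of_rank_2:
  assumes rk: "\<And>v q. v \<notin> D \<Longrightarrow> \<exists>x. br v x \<notin> span {q}"
  shows "iso_model br gC"
proof -
  \<comment> \<open>The two conditions confine ad (v2 - t v1) to the line of q, which
    \<open>rk\<close> forbids.\<close>
  have R: False if f: "frame v1 v2 c d" and 0: "br v1 v2 = 0"
    and cd: "br v2 c - t *\<^sub>R br v1 c \<in> span {q}" "br v2 d - t *\<^sub>R br v1 d \<in> span {q}" for v1 v2 c d t q
  proof -
    have f': "frame (v2 - t *\<^sub>R v1) v1 c d"
      by (rule frame_exchange_frame[OF frame_perm(1)[OF f], of _ 1 "- t" 0 0]) simp_all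
    have "br (v2 - t *\<^sub>R v1) x \<in> span {q}" for x
      by (rule frame_ad[OF f']) (use cd 0 br_swap[of v2 v1] in \<open>simp_all add: span_0\<close>)
    then show False using rk[OF frame_fst_notin[OF f']] by blast
  qed
  have "dim D < DIM('a)" using dim6 dimD by simp
  then obtain v1 where "v1 \<notin> D" using span_insert_less_dim[of D] by auto
  then obtain v2 v3 x where f: "frame v1 v2 v3 x" and b12: "br v1 v2 = 0" and
    p0: "br v1 v3 \<noteq> 0" and x: "br v1 x \<notin> span {br v1 v3}"
    using frame_of_rank_2 rk by blast
  define p where "p = br v1 v3"
  define r where "r = br v2 v3"
  \<comment> \<open>If r = t p, then v2 - t v1 commutes with v3, and the image of its adjoint map is
    spanned by its bracket with x.\<close>
  have "r \<notin> span {p}"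
  proof
    assume "r \<in> span {p}"
    then obtain t where "r = t *\<^sub>R p" by (auto simp: span_singleton)
    then show False using R[OF f b12, of t "br v2 x - t *\<^sub>R br v1 x"]
      by (simp add: r_def p_def span_0 span_base)
  qed
  then have D: "D = span {p, r}" 
    by (intro span_eq_of_dim_2 dimD) (use p0 in \<open>auto simp: p_def r_def\<close>)
  have ex: "\<exists>s t. br x y = s *\<^sub>R p + t *\<^sub>R r" for x y
    using br_in_derived[of br x y] unfolding D span_pair_iff .
  obtain s t where st: "br v3 x = s *\<^sub>R p + t *\<^sub>R r" using ex by blast
  obtain \<alpha> \<beta> where \<alpha>\<beta>: "br v1 x = \<alpha> *\<^sub>R p + \<beta> *\<^sub>R r" using ex by blast
  have \<beta>: "\<beta> \<noteq> 0" using x \<alpha>\<beta> by (auto simp: p_def span_singleton)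
  \<comment> \<open>The multiples of v1 and v2 cancel [v3, x]; the multiple of v3 and the factor
    1/\<beta> turn [v1, x] into r.\<close>
  define v4 where "v4 = (1/\<beta>) *\<^sub>R (x + s *\<^sub>R v1 + t *\<^sub>R v2 - \<alpha> *\<^sub>R v3)"
  have "frame x v1 v2 v3" using f by (meson frame_perm)
  then have "frame v4 v1 v2 v3"
    by (rule frame_exchange_frame[of _ _ _ _ _ "1/\<beta>" "s/\<beta>" "t/\<beta>" "-\<alpha>/\<beta>"])
      (simp_all add: \<beta> v4_def scaleR_add_right scaleR_diff_right)
  then have f4: "frame v1 v2 v3 v4" by (meson frame_perm)
  have b34: "br v3 v4 = 0"
    by (simp add: v4_def st br_swap[of v3 v1] br_swap[of v3 v2] flip: p_def r_def)
  have b14: "br v1 v4 = r" using \<beta> by (simp add: v4_def b12 \<alpha>\<beta> flip: p_def)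
  obtain c d where cd: "br v2 v4 = c *\<^sub>R p + d *\<^sub>R r" using ex by blast
  \<comment> \<open>The endomorphism of D that turns ad v1 into ad v2 sends p to r and r to c p + d
    r, so its trace is d. Subtracting d/2 makes it traceless: it sends p to r' and r' to k p, so its
    square is k.\<close>
  define v2' where "v2' = v2 - (d/2) *\<^sub>R v1"
  define v4' where "v4' = v4 - (d/2) *\<^sub>R v3"
  define r' where "r' = r - (d/2) *\<^sub>R p"
  define k where "k = c + d\<^sup>2 / 4"
  have "frame v2' v1 v3 v4"
    by (rule frame_exchange_frame[OF frame_perm(1)[OF f4], of _ 1 "- d/2" 0 0]) (simp_all add: v2'_def)
  then have "frame v4 v3 v1 v2'" by (meson frame_perm)
  then have "frame v4' v3 v1 v2'"
    by (rule frame_exchange_frame[of _ _ _ _ _ 1 "- d/2" 0 0]) (simp_all add: v4'_def)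
  then have f': "frame v1 v2' v3 v4'" by (meson frame_perm)
  have b': "br v1 v2' = 0" "br v3 v4' = 0" "br v1 v3 = p" "br v1 v4' = r'" "br v2' v3 = r'"
    by (simp_all add: v2'_def v4'_def r'_def b12 b34 b14 flip: p_def r_def)
  have b24: "br v2' v4' = k *\<^sub>R p"
  proof -
    have "br v2' v4' = (c + (d/2) * (d/2)) *\<^sub>R p + (d - d/2 - d/2) *\<^sub>R r"
      by (simp only: v2'_def v4'_def br_simps b14 cd p_def[symmetric] r_def[symmetric] 
         scaleR_add_left scaleR_diff_left scaleR_diff_right scaleR_scaleR) (simp add: algebra_simps)
    also have "\<dots> = k *\<^sub>R p" by (simp add: k_def power2_eq_square)
    finally show ?thesis .
  qed
  \<comment> \<open>For k \<ge> 0 the number \<open>sqrt k\<close> would be a real eigenvalue,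
    contrary to R.\<close>
  have "k < 0"
  proof (rule ccontr)
    assume "\<not> k < 0"
    then have k: "k = sqrt k * sqrt k" by simp
    have "k *\<^sub>R p - sqrt k *\<^sub>R r' = (- sqrt k) *\<^sub>R (r' - sqrt k *\<^sub>R p)"
      using k by (simp add: algebra_simps)
    also have "\<dots> \<in> span {r' - sqrt k *\<^sub>R p}" by (intro span_scale span_base) simp
    finally have "k *\<^sub>R p - sqrt k *\<^sub>R r' \<in> span {r' - sqrt k *\<^sub>R p}" .
    then show False
      using R[OF f' b'(1), of "sqrt k" "r' - sqrt k *\<^sub>R p"] by (simp add: b' b24 span_base)
  qed
  \<comment> \<open>Dividing v2' and v4' by m normalises the square of the endomorphism to -1, which
    gives the complex Heisenberg relations.\<close>
  define m where "m = sqrt (- k)"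
  have m: "m \<noteq> 0" "k = - (m * m)" using \<open>k < 0\<close> by (simp_all add: m_def)
  have "frame ((1/m) *\<^sub>R v2') v1 v3 v4'"
    by (rule frame_exchange_frame[OF frame_perm(1)[OF f'], of _ "1/m" 0 0 0]) (simp_all add: m)
  then have "frame v4' v1 ((1/m) *\<^sub>R v2') v3" by (meson frame_perm)
  then have "frame ((1/m) *\<^sub>R v4') v1 ((1/m) *\<^sub>R v2') v3"
    by (rule frame_exchange_frame[of _ _ _ _ _ "1/m" 0 0 0]) (simp_all add: m)
  then have "frame v1 ((1/m) *\<^sub>R v2') v3 ((1/m) *\<^sub>R v4')" by (meson frame_perm)
  then show ?thesis by (rule iso_gC) (use m in \<open>simp_all add: b' b24\<close>)
qed

lemma two_step_classification:
  "iso_model br gB \<or> iso_model br gC \<or> iso_model br gD \<or> iso_model br gE"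
proof (cases "\<exists>v q. v \<notin> D \<and> (\<forall>x. br v x \<in> span {q})")
  case True
  then show ?thesis using iso_of_rank_1 by blast
next
  case False
  then show ?thesis using iso_of_rank_2 by blast
qed

end

subsection \<open>The three-step case\<close>

locale complex_lie_alg_6_2 = lie_alg_6_2 br + complex_lie_alg br J
  for br :: "'a::euclidean_space \<Rightarrow> 'a \<Rightarrow> 'a" and J
begin

lemma three_step_iso_gA:
  assumes z0: "z \<noteq> 0" and zD: "z \<in> D" and gD: "\<And>x u. u \<in> D \<Longrightarrow> br x u \<in> span {z}"
    and z_central: "\<And>x. br x z = 0" and n2: "\<exists>x. \<exists>u\<in>D. br x u \<noteq> 0"
  shows "iso_model br gA"
proof -
  have z_central' [simp]: "br z x = 0" "br x z = 0" for x using z_central br_swap[of z x] by simp_all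
  obtain y0 t where t: "t \<in> D" "br y0 t \<noteq> 0" using n2 by blast
  then obtain k where k: "br y0 t = k *\<^sub>R z" using gD[of t y0] by (auto simp: span_singleton)
  define y where "y = (1/k) *\<^sub>R y0"
  have yt: "br y t = z" using t k by (auto simp: y_def)
  have tz: "t \<notin> span {z}" using t by (auto simp: span_singleton)
  have D: "D = span {z, t}" by (rule span_eq_of_dim_2[OF subspace_derived dimD zD t(1) z0 tz])
  have exD: "\<exists>r s. u = r *\<^sub>R z + s *\<^sub>R t" if "u \<in> D" for u using that D span_pair_iff by metis
  have DD: "br u u' = 0" if "u \<in> D" "u' \<in> D" for u u'
    using exD[OF that(1)] exD[OF that(2)] by auto

  define w where "w = J z"
  \<comment> \<open>If ad w were nonzero, \<open>J_central\<close> would make D invariant under J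
    and put w into D. Then the image of ad w would lie in the line of z and yet be invariant under
    J, but J preserves no real line.\<close>
  have w_central: "br w x = 0" for x
  proof (rule ccontr)
    assume nz: "br w x \<noteq> 0"
    have *: "J (br w x) = br w (J x)" "J ` D \<subseteq> D"
      using J_central[OF dimD, of z x] nz by (simp_all add: w_def)
    then have wD: "w \<in> D" using zD by (auto simp: w_def)
    have line: "\<exists>k. br w x = k *\<^sub>R z" for x
      using gD[OF wD, of x] br_swap[of w x] span_neg by (fastforce simp: span_singleton)
    obtain k where k: "br w x = k *\<^sub>R z" using line by blast
    obtain l where l: "J (br w x) = l *\<^sub>R z" using line[of "J x"] * by auto
    have "J (br w x) = (l / k) *\<^sub>R br w x" using k l nz by auto
    then have "J (br w x) \<in> span {br w x}" by (auto simp: span_singleton)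
    then show False using J_not_in_line[OF nz] by blast
  qed
  have w_central' [simp]: "br w x = 0" "br x w = 0" for x using w_central[of x] br_swap[of x w] by simp_all
  \<comment> \<open>Otherwise D would be spanned by the central vectors z and w, although t is not
    central.\<close>
  have wD: "w \<notin> D"
  proof
    assume "w \<in> D"
    then have "D = span {z, w}"
      using J_not_in_line[OF z0] by (intro span_eq_of_dim_2[OF subspace_derived dimD zD _ z0]) (auto simp: w_def)
    then obtain r s where "t = r *\<^sub>R z + s *\<^sub>R w" using t(1) span_pair_iff by metis
    then show False using t(2) by simp
  qed
  then have nJ: "\<not> J ` D \<subseteq> D" using zD by (auto simp: w_def)

  have 3: "dim (insert w D) = 3" using wD dimD by (simp add: dim_insert)
  \<comment> \<open>Vectors of D commute with t and w is central, whereas [y, t] = z is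
    nonzero.\<close>
  have "y \<notin> span (insert w D)"
  proof
    assume "y \<in> span (insert w D)"
    then obtain s where "y - s *\<^sub>R w \<in> D" by (auto simp: span_breakdown_eq)
    then have "br (y - s *\<^sub>R w) t = 0" using DD t by blast
    then show False using yt z0 by simp
  qed
  then have 4: "dim (insert y (insert w D)) = 4" using 3 by (simp add: dim_insert)
  obtain x2 where 5: "dim (insert x2 (insert y (insert w D))) = 5"
    using span_insert_less_dim[of "insert y (insert w D)"] 4 dim6 by auto
  obtain x1 where 6: "dim (insert x1 (insert x2 (insert y (insert w D)))) = 6"
    using span_insert_less_dim[of "insert x2 (insert y (insert w D))"] 5 dim6 by auto
  have f: "frame x1 x2 y w" unfolding frame_def using 6 dim6 by (metis dim_eq_full)

  \<comment> \<open>subtracting multiples of y and t from x kills [x, t] and the z-part of [y, x]\<close>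
  have adjust: "\<exists>x' g. br x' t = 0 \<and> br y x' = g *\<^sub>R t \<and> (\<forall>b. frame x b y w \<longrightarrow> frame x' b y w)" for x
  proof -
    obtain s where s: "br x t = s *\<^sub>R z" using gD[OF t(1), of x] by (auto simp: span_singleton)
    obtain h g where hg: "br y x = h *\<^sub>R z + g *\<^sub>R t" using exD[of "br y x"] by auto
    let ?x = "x - s *\<^sub>R y - h *\<^sub>R t"
    have u: "- h *\<^sub>R t \<in> D" by (rule subspace_scale[OF subspace_derived t(1)])
    have "frame ?x b y w" if "frame x b y w" for b
      by (rule frame_exchange[OF that _ _ u, of _ 1 0 "- s" 0]) simp_all
    moreover have "br ?x t = 0" "br y ?x = g *\<^sub>R t" by (simp_all add: s yt hg)
    ultimately show ?thesis by blast
  qed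
  obtain x1' g1 where x1: "br x1' t = 0" "br y x1' = g1 *\<^sub>R t" "frame x1' x2 y w"
    using adjust[of x1] f by blast
  have "frame x2 x1' y w" using x1(3) by (rule frame_perm)
  then obtain x2' g2 where x2: "br x2' t = 0" "br y x2' = g2 *\<^sub>R t" "frame x2' x1' y w"
    using adjust[of x2] by blast
  \<comment> \<open>Since \<open>a\<close> and c commute with t, the Jacobi identity for y, a, c
    reduces to s z = 0, where s is the t-component of [a, c].\<close>
  have line: "\<exists>b. br a c = b *\<^sub>R z" if "br a t = 0" "br c t = 0" "br y a = g *\<^sub>R t" "br y c = g' *\<^sub>R t" for a c g g'
  proof -
    obtain r s where rs: "br a c = r *\<^sub>R z + s *\<^sub>R t" using exD[of "br a c"] by auto
    have "br y (br a c) + br a (br c y) + br c (br y a) = 0" by (rule jacobi)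
    then have "s *\<^sub>R z = 0" using that br_swap[of c y] by (simp add: rs yt)
    then show ?thesis using rs z0 by auto
  qed
  \<comment> \<open>If both vanished, every bracket of the frame would lie in the line of z.\<close>
  have "g1 \<noteq> 0 \<or> g2 \<noteq> 0"
  proof (rule ccontr)
    assume g: "\<not> ?thesis"
    obtain b where b: "br x2' x1' = b *\<^sub>R z" using line x1 x2 by blast
    have "D \<subseteq> span {z}"
    proof (rule frame_derived[OF x2(3)])
      show "br x2' y \<in> span {z}" "br x1' y \<in> span {z}"
        using g x1 x2 br_swap[of x1' y] br_swap[of x2' y] by (simp_all add: span_0)
    qed (use b gD in \<open>auto simp: span_0 span_scale span_base\<close>)
    then show False using D_not_line by blast
  qed
  then obtain x1 x2 g1 g2 where f: "frame x2 x1 y w" and g1: "g1 \<noteq> 0" and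
    x1: "br x1 t = 0" "br y x1 = g1 *\<^sub>R t" and x2: "br x2 t = 0" "br y x2 = g2 *\<^sub>R t"
    using x1 x2 frame_perm(1)[OF x2(3)] by blast
  \<comment> \<open>This combination commutes with y as well as with t, so [x1, x] = b z is its only
    bracket left to determine; b is the remaining invariant scalar.\<close>
  define x where "x = x2 - (g2 / g1) *\<^sub>R x1"
  have fx: "frame x x1 y w" by (rule frame_exchange_frame[OF f, of _ 1 "- g2 / g1" 0 0]) (simp_all add: x_def)
  have x: "br x t = 0" "br y x = 0 *\<^sub>R t" using g1 by (simp_all add: x_def x1 x2)
  obtain b where b: "br x1 x = b *\<^sub>R z" using line[OF x1(1) x(1) x1(2) x(2)] by blast
  have b0: "b \<noteq> 0"
  proof
    \<comment> \<open>Now x is central, and J x is central because D is not J-invariant. Centrality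
      confines J x to the span of x, w and z, and comparing the x-components in J (J x) = - x gives
      \<alpha>^2 + 1 = 0.\<close>
    assume b0: "b = 0"
    have xc: "br x v = 0" for v
    proof -
      have "br x v \<in> {0}"
      proof (rule frame_ad[OF fx])
        fix u assume "u \<in> D"
        then show "br x u \<in> {0}" using exD[of u] x by auto
      qed (use b b0 x br_swap[of x x1] br_swap[of x y] in \<open>auto simp: subspace_0 subspace_single_0\<close>)
      then show ?thesis by simp
    qed
    have Jxc: "br (J x) v = 0" for v using J_central(2)[OF dimD xc] nJ by blast
    obtain \<alpha> \<beta> \<gamma> \<delta> u where u: "u \<in> D" and Jx: "J x = \<alpha> *\<^sub>R x + \<beta> *\<^sub>R x1 + \<gamma> *\<^sub>R y + \<delta> *\<^sub>R w + u"
      using frame_expand[OF fx] by blast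
    obtain r s where rs: "u = r *\<^sub>R z + s *\<^sub>R t" using exD[OF u] by blast
    have "br (J x) t = \<gamma> *\<^sub>R z" by (simp add: Jx rs x x1 yt)
    then have \<gamma>: "\<gamma> = 0" using Jxc z0 by simp
    have "br y (J x) = (\<beta> * g1) *\<^sub>R t + s *\<^sub>R z" by (simp add: Jx rs x x1 yt)
    then have ts: "(\<beta> * g1) *\<^sub>R t + s *\<^sub>R z = 0" using Jxc[of y] br_swap[of y "J x"] by simp
    have \<beta>: "\<beta> = 0"
    proof (rule ccontr)
      assume "\<beta> \<noteq> 0"
      moreover have "(\<beta> * g1) *\<^sub>R t = (- s) *\<^sub>R z" using ts by (simp add: eq_neg_iff_add_eq_0)
      moreover have "t = (1 / (\<beta> * g1)) *\<^sub>R (\<beta> * g1) *\<^sub>R t" using \<open>\<beta> \<noteq> 0\<close> g1 by simp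
      ultimately have "t = (- s / (\<beta> * g1)) *\<^sub>R z" by simp
      then show False using tz by (metis insertI1 span_base span_scale)
    qed
    then have s: "s = 0" using ts z0 by simp
    have Jx: "J x = \<alpha> *\<^sub>R x + \<delta> *\<^sub>R w + r *\<^sub>R z" using Jx \<beta> \<gamma> s rs by simp
    have Jw: "J w = - z" by (simp add: w_def)
    have "- x = J (J x)" by simp
    also have "\<dots> = \<alpha> *\<^sub>R J x + \<delta> *\<^sub>R J w + r *\<^sub>R J z" by (subst Jx) simp
    also have "\<dots> = (\<alpha> * \<alpha>) *\<^sub>R x + (\<alpha> * \<delta> + r) *\<^sub>R w + (\<alpha> * r - \<delta>) *\<^sub>R z"
      by (simp add: Jx Jw algebra_simps flip: w_def)
    finally have "(\<alpha> * \<alpha> + 1) *\<^sub>R x + 0 *\<^sub>R x1 + 0 *\<^sub>R y + (\<alpha> * \<delta> + r) *\<^sub>R w = (\<delta> - \<alpha> * r) *\<^sub>R z"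
      by (simp add: algebra_simps)
    moreover have "(\<delta> - \<alpha> * r) *\<^sub>R z \<in> D" using zD by (auto intro: subspace_scale)
    moreover have "\<alpha> * \<alpha> + 1 \<noteq> 0" using zero_le_square[of \<alpha>] by linarith
    ultimately show False using frame_notin[OF fx] by metis
  qed
  \<comment> \<open>Scaled so that [x1, e4] equals [y, g1 t], as the entry 14+25 demands. The
    central vector w takes the place of the third basis vector, which occurs in no bracket of the
    model.\<close>
  define e4 where "e4 = (g1 / b) *\<^sub>R x"
  have "frame e4 x1 y w"
    by (rule frame_exchange_frame[OF fx, of _ "g1 / b" 0 0 0]) (use g1 b0 in \<open>simp_all add: e4_def\<close>)
  then have f4: "frame x1 y w e4" by (meson frame_perm)
  have br: "br x1 y = - (g1 *\<^sub>R t)" "br x1 e4 = g1 *\<^sub>R z" "br y e4 = 0" "br e4 t = 0"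
    using b0 by (simp_all add: br_swap[of x1 y] x1 e4_def b x)
  show ?thesis
  proof (rule iso_model_six[OF dim6])
    let ?S = "{x1, y, w, e4, g1 *\<^sub>R t, - (g1 *\<^sub>R z)}"
    have "z = (- 1 / g1) *\<^sub>R (- (g1 *\<^sub>R z))" "t = (1 / g1) *\<^sub>R (g1 *\<^sub>R t)" using g1 by simp_all
    then have "z \<in> span ?S" "t \<in> span ?S" by (metis insertCI span_base span_scale)+
    then have "D \<subseteq> span ?S" unfolding D by (intro span_minimal) auto
    then have "span (insert x1 (insert y (insert w (insert e4 D)))) \<subseteq> span ?S"
      by (intro span_minimal) (auto intro: span_base)
    then show "span ?S = UNIV" using f4 by (auto simp: frame_def)
    show "\<forall>i\<in>{1..6}. \<forall>j\<in>{1..6}. i < j \<longrightarrow>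
      br ([0, x1, y, w, e4, g1 *\<^sub>R t, - (g1 *\<^sub>R z)] ! i) ([0, x1, y, w, e4, g1 *\<^sub>R t, - (g1 *\<^sub>R z)] ! j)
        = - (\<Sum>k\<in>{1..6}. dcoef gA k i j *\<^sub>R [0, x1, y, w, e4, g1 *\<^sub>R t, - (g1 *\<^sub>R z)] ! k)"
      by (simp add: atLeastAtMost_1_6 dcoef_def gA_def br x1(1) yt)
  qed
qed

end

subsection \<open>The lower central series\<close>

lemma subspace_lcs: "subspace (lcs br k)"
  by (cases k) simp_all

lemma lcs_antimono: "lcs br (Suc k) \<subseteq> lcs br k"
proof (induction k)
  case (Suc k)
  then show ?case unfolding lcs.simps(2)[of br "Suc k"] lcs.simps(2)[of br k]
    by (intro span_mono) blast
qed simp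

lemma br_in_lcs: "y \<in> lcs br k \<Longrightarrow> br x y \<in> lcs br (Suc k)"
  by (auto intro: span_base)

text \<open>Once two consecutive terms agree, the series is constant from there on and could not
  reach 0.\<close>

lemma lcs_strict:
  assumes "nilpotent_lie br" "lcs br k \<noteq> {0}"
  shows "lcs br (Suc k) \<subset> lcs br k"
proof (rule ccontr)
  assume "\<not> ?thesis"
  then have eq: "lcs br (Suc k) = lcs br k" using lcs_antimono[of br k] by blast
  have const: "lcs br (n + k) = lcs br k" for n
  proof (induction n)
    case (Suc n)
    then have "lcs br (Suc (n + k)) = lcs br (Suc k)" by simp
    then show ?case using eq by simp
  qed simp
  obtain m where m: "lcs br m = {0}" using assms(1) by (auto simp: nilpotent_lie_def)
  have "lcs br (n + m) \<subseteq> lcs br m" for n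
    by (induction n) (use lcs_antimono in fastforce)+
  then have "lcs br (k + m) \<subseteq> {0}" using m by metis
  then have "lcs br k \<subseteq> {0}" using const[of m] by (simp add: add.commute)
  then show False using assms(2) subspace_0[OF subspace_lcs[of br k]] by auto
qed

text \<open>With this indexing \<open>lcs br 1\<close> is D and \<open>lcs br 2\<close> is [g, D].
  If [g, D] is nonzero, the strict decrease of dimensions from 2 leaves dimension 1 for
  \<open>lcs br 2\<close> and 0 for \<open>lcs br 3\<close>; z generates the former and is central
  by the latter.\<close>

lemma nilpotent_cases:
  fixes br :: "'a::euclidean_space \<Rightarrow> 'a \<Rightarrow> 'a"
  assumes nil: "nilpotent_lie br" and dim: "dim (derived br) = 2"
  obtains "\<And>x u. u \<in> derived br \<Longrightarrow> br x u = 0"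
  | z where "z \<noteq> 0" "z \<in> derived br" "\<And>x u. u \<in> derived br \<Longrightarrow> br x u \<in> span {z}"
      "\<And>x. br x z = 0" "\<exists>x. \<exists>u\<in>derived br. br x u \<noteq> 0"
proof (cases "\<forall>x. \<forall>u\<in>derived br. br x u = 0")
  case True
  then show ?thesis using that(1) by blast
next
  case False
  have strict: "dim (lcs br (Suc k)) < dim (lcs br k)" if "lcs br k \<noteq> {0}" for k
    using lcs_strict[OF nil that] by (intro dim_psubset) (simp only: span_eq_iff[THEN iffD2] subspace_lcs)
  have in2: "br x u \<in> lcs br 2" if "u \<in> derived br" for x u
    using that by (metis Suc_1 br_in_lcs lcs_1)
  have "lcs br 2 \<noteq> {0}" using False in2 by (metis singletonD)
  moreover have "lcs br 1 \<noteq> {0}" 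
    using dim dim_eq_0[of "derived br"] unfolding lcs_1 by (metis order_refl zero_neq_numeral)
  ultimately have "dim (lcs br 2) < 2" "dim (lcs br 3) < dim (lcs br 2)"
    using strict[of 1] strict[of 2] dim unfolding lcs_1 Suc_1 eval_nat_numeral(3)[of Num.One, symmetric]
    by auto
  then have d: "dim (lcs br 2) = 1" "dim (lcs br 3) = 0" by linarith+
  obtain z where z: "z \<in> lcs br 2" "z \<noteq> 0"
    using \<open>lcs br 2 \<noteq> {0}\<close> subspace_0[OF subspace_lcs[of br 2]] by blast
  have "span {z} = lcs br 2"
    using z d subspace_lcs[of br 2] by (intro subspace_dim_equal) (auto simp del: lcs.simps intro: span_minimal[THEN subsetD])
  moreover have "lcs br 2 \<subseteq> derived br"
    using lcs_antimono[of br 1] unfolding lcs_1 Suc_1 .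
  moreover have "br x z = 0" for x
    using br_in_lcs[OF z(1), of x] d(2) unfolding eval_nat_numeral(3)[of Num.One, symmetric] by auto
  ultimately show ?thesis using that(2)[of z] z in2 False by blast
qed

subsection \<open>The classification\<close>

text \<open>In each of the four models \<open>e 5\<close> and \<open>e 6\<close> are central, every
  bracket lies in their span, and each of them is up to sign a bracket. This provides the hypotheses
  of \<open>two_step_derived_J_invariant\<close>.\<close>

lemma two_step_models:
  fixes br :: "'a::euclidean_space \<Rightarrow> 'a \<Rightarrow> 'a"
  assumes lie: "lie_algebra br" and L: "iso_model br L" "L \<in> {gB, gC, gD, gE}"
  shows "dim (derived br) = 2" "u \<in> derived br \<Longrightarrow> br x u = 0"
proof -
  interpret lie_alg br by unfold_locales fact
  obtain e :: "nat \<Rightarrow> 'a" where inj: "inj_on e {1..6}" and ind: "independent (e ` {1..6})"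
    and sp: "span (e ` {1..6}) = UNIV"
    and br: "\<forall>i\<in>{1..6}. \<forall>j\<in>{1..6}. i < j \<longrightarrow> br (e i) (e j) = - (\<Sum>k\<in>{1..6}. dcoef L k i j *\<^sub>R e k)"
    using L(1) unfolding iso_model_def by blast
  have sp': "span {e 1, e 2, e 3, e 4, e 5, e 6} = UNIV" using sp by (simp add: atLeastAtMost_1_6)
  let ?T = "span {e 5, e 6}"
  have mem: "e 5 \<in> ?T" "e 6 \<in> ?T" "0 \<in> ?T" "- e 5 \<in> ?T" "- e 6 \<in> ?T"
    by (auto intro: span_base span_neg span_0)
  have br56: "br (e i) (e 5) = 0 \<and> br (e i) (e 6) = 0" if "i \<in> {1..6}" for i
  proof -
    have "br (e 1) (e 5) = 0" "br (e 2) (e 5) = 0" "br (e 3) (e 5) = 0" "br (e 4) (e 5) = 0"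
      "br (e 1) (e 6) = 0" "br (e 2) (e 6) = 0" "br (e 3) (e 6) = 0" "br (e 4) (e 6) = 0" "br (e 5) (e 6) = 0"
      using br L(2) by (auto simp: atLeastAtMost_1_6 dcoef_def gB_def gC_def gD_def gE_def)
    then show ?thesis using that br_swap[of "e 6" "e 5"] by (auto simp: atLeastAtMost_1_6)
  qed
  have "subspace {x. br x (e 5) = 0 \<and> br x (e 6) = 0}" by (simp add: subspace_def)
  then have "span (e ` {1..6}) \<subseteq> {x. br x (e 5) = 0 \<and> br x (e 6) = 0}"
    using br56 by (intro span_minimal) blast
  then have c: "br x (e 5) = 0" "br x (e 6) = 0" for x using sp by auto
  then have c': "br (e 5) x = 0" "br (e 6) x = 0" for x using br_swap[of _ x] by simp_all
  have m: "br (e 1) (e 2) \<in> ?T" "br (e 1) (e 3) \<in> ?T" "br (e 1) (e 4) \<in> ?T"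
    "br (e 2) (e 3) \<in> ?T" "br (e 2) (e 4) \<in> ?T" "br (e 3) (e 4) \<in> ?T"
    using br L(2) mem by (auto simp: atLeastAtMost_1_6 dcoef_def gB_def gC_def gD_def gE_def)
  have neg: "br y x \<in> ?T" if "br x y \<in> ?T" for x y
    using that span_neg br_swap by metis
  have "derived br \<subseteq> ?T"
  proof (rule derived_subset[OF sp'])
    fix x y assume "x \<in> {e 1, e 2, e 3, e 4, e 5, e 6}" "y \<in> {e 1, e 2, e 3, e 4, e 5, e 6}"
    then show "br x y \<in> ?T"
      by (elim insertE emptyE; simp only: m m[THEN neg] c c' br_self span_0)
  qed simp
  moreover have "br (e 1) (e 2) = - e 5 \<or> br (e 1) (e 3) = - e 5"
    "br (e 1) (e 3) = - e 6 \<or> br (e 1) (e 4) = - e 6 \<or> br (e 3) (e 4) = - e 6"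
    using br L(2) by (auto simp: atLeastAtMost_1_6 dcoef_def gB_def gC_def gD_def gE_def)
  then have "- e 5 \<in> derived br" "- e 6 \<in> derived br" by (metis br_in_derived)+
  then have "e 5 \<in> derived br" "e 6 \<in> derived br"
    using subspace_neg[OF subspace_derived, of _ br] by (metis minus_minus)+
  then have "?T \<subseteq> derived br" by (intro span_minimal) auto
  ultimately have T: "derived br = ?T" by blast
  have "e 5 \<noteq> e 6" using inj_onD[OF inj, of 5 6] by auto
  moreover have "independent {e 5, e 6}" using ind by (rule independent_mono) auto
  ultimately show "dim (derived br) = 2" unfolding T by (simp add: dim_eq_card_independent)
  assume "u \<in> derived br"
  then obtain s t where u: "u = s *\<^sub>R e 5 + t *\<^sub>R e 6" unfolding T span_pair_iff by blast
  then show "br x u = 0" by (simp add: c)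
qed

theorem theorem3p3:
  fixes br :: "'a::euclidean_space \<Rightarrow> 'a \<Rightarrow> 'a"
  assumes "DIM('a) = 6"
    and "lie_algebra br"
    and "nilpotent_lie br"
    and "b1 br = 4"
    and "\<exists>J. complex_structure br J"
  shows "(iso_model br gA \<or> iso_model br gB \<or> iso_model br gC \<or> iso_model br gD \<or> iso_model br gE)
    \<and> (\<forall>(br' :: 'a \<Rightarrow> 'a \<Rightarrow> 'a) J. lie_algebra br' \<and>
          (iso_model br' gB \<or> iso_model br' gC \<or> iso_model br' gD \<or> iso_model br' gE) \<and>
          complex_structure br' J \<longrightarrow> (\<forall>\<alpha>\<in>V1 br'. \<alpha> \<circ> J \<in> V1 br'))"
proof (intro conjI allI impI ballI)
  obtain J where J: "complex_structure br J" using assms(5) by blast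
  have dimD: "dim (derived br) = 2" using dim_derived[of br] assms(1,4) by simp
  interpret complex_lie_alg_6_2 br J
    using assms(1,2) dimD J by unfold_locales
  from assms(3) dimD
  show "iso_model br gA \<or> iso_model br gB \<or> iso_model br gC \<or> iso_model br gD \<or> iso_model br gE"
  proof (cases rule: nilpotent_cases)
    case 1
    then interpret two_step_6_2 br by unfold_locales
    show ?thesis using two_step_classification by blast
  next
    case (2 z)
    then show ?thesis using three_step_iso_gA by blast
  qed
next
  fix br' :: "'a \<Rightarrow> 'a \<Rightarrow> 'a" and J \<alpha>
  assume asm: "lie_algebra br' \<and>
          (iso_model br' gB \<or> iso_model br' gC \<or> iso_model br' gD \<or> iso_model br' gE) \<and>
          complex_structure br' J" and \<alpha>: "\<alpha> \<in> V1 br'"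
  interpret complex_lie_alg br' J using asm by unfold_locales auto
  obtain L where L: "iso_model br' L" "L \<in> {gB, gC, gD, gE}" using asm by blast
  have central: "br' u x = 0" if "u \<in> derived br'" for x u
    using two_step_models(2)[OF lie L that, of x] br_swap[of u x] by simp
  \<comment> \<open>V_1 is the annihilator of the derived algebra, so invariance of the latter under
    J passes to V_1 by duality.\<close>
  have JD: "J ` derived br' \<subseteq> derived br'"
    by (rule two_step_derived_J_invariant[OF assms(1) two_step_models(1)[OF lie L] central])
  have lin: "linear \<alpha>" and \<alpha>0: "\<And>x y. \<alpha> (br' x y) = 0" using \<alpha> by (auto simp: V1_def)
  have "subspace {u. \<alpha> u = 0}" using lin by (simp add: subspace_def linear_add linear_scale linear_0)
  then have "derived br' \<subseteq> {u. \<alpha> u = 0}"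
    unfolding derived_def using \<alpha>0 by (intro span_minimal) auto
  then have "\<alpha> (J (br' x y)) = 0" for x y using JD br_in_derived[of br' x y] by blast
  then show "\<alpha> \<circ> J \<in> V1 br'" using lin linear_J by (simp add: V1_def linear_compose)
qed

end
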